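(* Let $f(z)=z+a_2z^2+a_3z^3+\cdots\in\mathcal{S}^{*}_{\arcsin}$, with logarithmic coefficients $\gamma_1,\gamma_2,\gamma_3,\gamma_4$. Then $$|\gamma_n|\le \frac{1}{n\pi},\qquad n=1,2,3,4.$$ The estimates are sharp, i.e. for each $n\in\{1,2,3,4\}$ there is a function in $\mathcal{S}^{*}_{\arcsin}$ for which equality holds.
   Context: Let $\Omega=\{z\in\mathbb{C}:|z|<1\}$. Let $\mathcal{A}$ be the family of analytic functions $f$ on $\Omega$ normalized by $f(z)=z+\sum_{n\ge 2}a_nz^n$, and let $\mathcal{S}\subset\mathcal{A}$ be the subclass of univalent (injective) functions. A Schwarz function is an analytic function $\omega$ on $\Omega$ with $\omega(0)=0$ and $|\omega(z)|\le 1$ for all $z\in\Omega$. For $g,h$ analytic in $\Omega$, $g\prec h$ ($g$ is subordinate to $h$) means there is a Schwarz function $\omega$ with $g(z)=h(\omega(z))$ for all $z\in\Omega$. With $\arcsin$ denoting the principal branch (analytic in $\Omega$, $\arcsin 0=0$), define $$\mathcal{S}^{*}_{\arcsin}=\left\{f\in\mathcal{S}:\ \frac{zf'(z)}{f(z)}\prec 1+\frac{2}{\pi}\arcsin z\right\},$$ where $zf'(z)/f(z)$ is understood to take the value $1$ at $z=0$. The logarithmic coefficients $\gamma_n$ of $f\in\mathcal{S}$ are defined by $\log\frac{f(z)}{z}=2\sum_{n\ge 1}\gamma_nz^n$ (with $\log 1=0$). Explicitly, $\gamma_1=\frac12a_2$, $\gamma_2=\frac12\left(a_3-\frac12a_2^2\right)$,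 $\gamma_3=\frac12\left(a_4-a_2a_3+\frac13a_2^3\right)$, $\gamma_4=\frac12\left(a_5-a_2a_4+a_2^2a_3-\frac12a_3^2-\frac14a_2^4\right)$. *)

theory Defs
  imports "HOL-Complex_Analysis.Complex_Analysis"
begin

abbreviation unit_disc :: "complex set" where
  "unit_disc \<equiv> ball 0 1"

definition class_A :: "(complex \<Rightarrow> complex) set" where
  "class_A = {f. f holomorphic_on unit_disc \<and> f 0 = 0 \<and> deriv f 0 = 1}"

definition class_S :: "(complex \<Rightarrow> complex) set" where
  "class_S = {f \<in> class_A. inj_on f unit_disc}"

definition schwarz_function :: "(complex \<Rightarrow> complex) \<Rightarrow> bool" where
  "schwarz_function \<omega> \<longleftrightarrow>
     \<omega> holomorphic_on unit_disc \<and> \<omega> 0 = 0 \<and> (\<forall>z\<in>unit_disc. cmod (\<omega> z) \<le> 1)"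

definition subordinate :: "(complex \<Rightarrow> complex) \<Rightarrow> (complex \<Rightarrow> complex) \<Rightarrow> bool"
    (infix "\<prec>\<^sub>s" 50) where
  "g \<prec>\<^sub>s h \<longleftrightarrow> (\<exists>\<omega>. schwarz_function \<omega> \<and> (\<forall>z\<in>unit_disc. g z = h (\<omega> z)))"

definition starlike_arcsin :: "(complex \<Rightarrow> complex) set" where
  "starlike_arcsin = {f \<in> class_S.
     (\<lambda>z. if z = 0 then 1 else z * deriv f z / f z) \<prec>\<^sub>s
     (\<lambda>z. 1 + 2 / of_real pi * Arcsin z)}"

text \<open>
  The principal value \<open>Ln (f z / z)\<close> need not be continuous on the whole disc for a univalent
  \<open>f\<close>, so \<open>log (f z / z)\<close> is taken to be the analytic branch vanishing at the origin.
  Its values on the disc are uniquely determined; its values elsewhere are irrelevant.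
\<close>

definition is_log_quotient :: "(complex \<Rightarrow> complex) \<Rightarrow> (complex \<Rightarrow> complex) \<Rightarrow> bool" where
  "is_log_quotient f L \<longleftrightarrow>
     L holomorphic_on unit_disc \<and> L 0 = 0 \<and> (\<forall>z\<in>unit_disc - {0}. exp (L z) = f z / z)"

definition log_quotient :: "(complex \<Rightarrow> complex) \<Rightarrow> complex \<Rightarrow> complex" where
  "log_quotient f = (SOME L. is_log_quotient f L)"

definition log_coeff :: "(complex \<Rightarrow> complex) \<Rightarrow> nat \<Rightarrow> complex" where
  "log_coeff f n = fps_nth (fps_expansion (log_quotient f) 0) n / 2"

lemma is_log_quotient_unique:
  assumes "is_log_quotient f L" "is_log_quotient f M" "z \<in> unit_disc"
  shows "L z = M z"
proof -
  define D where "D = (\<lambda>z. L z - M z)"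
  have L: "L holomorphic_on unit_disc" "L 0 = 0" and M: "M holomorphic_on unit_disc" "M 0 = 0"
    using assms by (auto simp: is_log_quotient_def)
  have D: "D holomorphic_on unit_disc"
    unfolding D_def using L M by (intro holomorphic_intros) auto
  have e: "exp (D w) = 1" if "w \<in> unit_disc" for w
  proof (cases "w = 0")
    case True
    then show ?thesis using L M by (simp add: D_def)
  next
    case False
    then have "exp (L w) = exp (M w)"
      using assms that unfolding is_log_quotient_def by simp
    then show ?thesis by (simp add: D_def exp_diff)
  qed
  have d: "(D has_field_derivative 0) (at w)" if w: "w \<in> unit_disc" for w
  proof -
    have Dw: "(D has_field_derivative deriv D w) (at w)"
      using holomorphic_derivI[OF D _ w] by simp
    have "((\<lambda>w. exp (D w)) has_field_derivative exp (D w) * deriv D w) (at w)"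
      by (rule DERIV_chain2[OF DERIV_exp Dw])
    moreover have "((\<lambda>w. exp (D w)) has_field_derivative 0) (at w)"
      by (rule has_field_derivative_transform_within_open[where f="\<lambda>_. 1" and S=unit_disc])
         (use w e in auto)
    ultimately have "exp (D w) * deriv D w = 0"
      by (rule DERIV_unique)
    then show ?thesis using Dw by simp
  qed
  obtain c where "\<And>x. x \<in> unit_disc \<Longrightarrow> D x = c"
    using has_field_derivative_zero_constant[of unit_disc D] d
    by (metis convex_ball has_field_derivative_at_within)
  then have "D z = D 0" using assms(3) by auto
  then show ?thesis using L M by (simp add: D_def)
qed

lemma is_log_quotient_exists:
  assumes "f \<in> class_S"
  shows "\<exists>L. is_log_quotient f L"
proof -
  have f: "f holomorphic_on unit_disc" "f 0 = 0" "deriv f 0 = 1" "inj_on f unit_disc"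
    using assms by (auto simp: class_S_def class_A_def)
  define g where "g = (\<lambda>z. if z = 0 then deriv f 0 else (f z - f 0) / (z - 0))"
  have g: "g holomorphic_on unit_disc"
    unfolding g_def by (rule pole_theorem_open_0[where a=0 and g = "\<lambda>z. f z - f 0"])
      (use f in \<open>auto intro!: holomorphic_intros\<close>)
  have nz: "g z \<noteq> 0" if "z \<in> unit_disc" for z
    using that f inj_onD[OF f(4), of z 0] by (auto simp: g_def)
  obtain h where h: "h holomorphic_on unit_disc" "\<And>z. z \<in> unit_disc \<Longrightarrow> g z = exp (h z)"
    using contractible_imp_holomorphic_log[OF g convex_imp_contractible[OF convex_ball] nz] by metis
  have h0: "exp (h 0) = 1" using h(2)[of 0] f by (simp add: g_def)
  have "is_log_quotient f (\<lambda>z. h z - h 0)"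
    unfolding is_log_quotient_def
    using h f h0 by (auto intro!: holomorphic_intros simp: exp_diff g_def simp flip: h(2))
  then show ?thesis by blast
qed

lemma is_log_quotient_log_quotient:
  "f \<in> class_S \<Longrightarrow> is_log_quotient f (log_quotient f)"
  unfolding log_quotient_def by (metis is_log_quotient_exists someI_ex)

lemma log_coeff_sums:
  assumes "f \<in> class_S" "z \<in> unit_disc"
  shows "(\<lambda>n. 2 * log_coeff f (Suc n) * z ^ Suc n) sums log_quotient f z"
proof -
  have L: "log_quotient f holomorphic_on unit_disc" "log_quotient f 0 = 0"
    using is_log_quotient_log_quotient[OF assms(1)] by (auto simp: is_log_quotient_def)
  have "(\<lambda>n. 2 * log_coeff f n * z ^ n) sums log_quotient f z"
    using holomorphic_power_series[OF L(1) assms(2)]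
    by (simp add: log_coeff_def fps_expansion_def)
  moreover have "log_coeff f 0 = 0"
    using L by (simp add: log_coeff_def fps_expansion_def)
  ultimately show ?thesis
    by (subst sums_Suc_iff) simp
qed

end

(*
  If z f'(z) / f(z) = 1 + (2 / pi) arcsin (omega z), then the coefficient of z^n in
  arcsin (omega z) is n pi gamma_n. The function arcsin maps the disc onto the convex region
  sinh |y| < cos x, |x| < pi / 2, so Rogosinski's theorem for convex majorants bounds that
  coefficient by arcsin'(0) = 1, for every n >= 1. Equality is attained for omega z = z^n.
*)

theory Submission
  imports Defs
begin

unbundle no vec_syntax  (* frees $ for fps_nth *)

section \<open>Coefficients of composed power series and Cauchy estimates\<close>

text \<open>For \<open>i \<ge> 2\<close> the power \<open>F ^ i\<close> has order at least
  \<open>2 * n\<close>, beyond \<open>n\<close>, and \<open>F ^ 0\<close> contributes only to the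
  constant term; the linear term of \<open>A\<close> alone survives.\<close>

lemma fps_compose_nth_initial:
  fixes A F :: "'a::field_char_0 fps"
  assumes F: "\<And>m. m < n \<Longrightarrow> F $ m = 0" and "n > 0"
  shows "(A oo F) $ n = A $ 1 * F $ n"
proof -
  have pow: "F ^ i $ n = 0" if "i \<ge> 2" for i
  proof (cases "F = 0")
    case True
    then show ?thesis using that by (simp add: power_0_left)
  next
    case False
    then have "subdegree F \<ge> n"
      using F by (intro subdegree_geI) auto
    then have "n * i \<le> subdegree F * i" by (rule mult_le_mono1)
    moreover have "n * 2 \<le> n * i" using that by (intro mult_le_mono2)
    ultimately have "n < subdegree (F ^ i)"
      using \<open>n > 0\<close> unfolding subdegree_power by (metis (no_types) less_le_trans mult.commute mult_2 less_add_same_cancel1)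
    then show ?thesis by (rule nth_less_subdegree_zero)
  qed
  have "(A oo F) $ n = (\<Sum>i\<in>{0..n}. if i = 1 then A $ 1 * F $ n else 0)"
    unfolding fps_compose_nth
  proof (intro sum.cong refl)
    fix i :: nat
    consider "i = 0" | "i = 1" | "i \<ge> 2" by linarith
    then show "A $ i * F ^ i $ n = (if i = 1 then A $ 1 * F $ n else 0)"
      by cases (use pow \<open>n > 0\<close> in auto)
  qed
  also have "\<dots> = A $ 1 * F $ n"
    using \<open>n > 0\<close> by simp
  finally show ?thesis .
qed

text \<open>Since \<open>f\<close> is controlled only on the open disc, Cauchy's inequality is
  applied on circles of radius \<open>r < 1\<close>, and then \<open>r\<close> tends to 1.\<close>

lemma cauchy_coeff_bound:
  assumes f: "f holomorphic_on ball 0 1" "f has_fps_expansion F"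
    and bd: "\<And>z. z \<in> ball 0 1 \<Longrightarrow> cmod (f z) \<le> B"
  shows "cmod (F $ n) \<le> B"
proof -
  have le: "cmod (F $ n) * r ^ n \<le> B" if r: "0 < r" "r < 1" for r
  proof -
    have "cmod ((deriv ^^ n) f 0) \<le> fact n * B / r ^ n"
      using r f(1) bd
      by (intro Cauchy_inequality)
         (auto intro: holomorphic_on_subset intro!: holomorphic_on_imp_continuous_on[OF holomorphic_on_subset[OF f(1)]])
    then show ?thesis
      using r by (simp add: fps_nth_fps_expansion[OF f(2)] norm_divide field_simps)
  qed
  have "((\<lambda>r. cmod (F $ n) * r ^ n) \<longlongrightarrow> cmod (F $ n) * 1 ^ n) (at_left 1)"
    by (intro tendsto_intros)
  moreover have "\<forall>\<^sub>F r in at_left (1::real). cmod (F $ n) * r ^ n \<le> B"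
    using eventually_at_left_real[of 0 1] by (rule eventually_mono) (use le in auto)
  ultimately show ?thesis
    using tendsto_upperbound[of _ _ "at_left (1::real)"] by fastforce
qed

section \<open>Roots of unity and Rogosinski's theorem for convex majorants\<close>

lemma cis_root_of_unity:
  assumes "n > 0"
  shows "cis (2 * pi / real n) ^ n = 1"
proof -
  have eq: "real n * (2 * pi / real n) = 2 * pi" using assms by simp
  show ?thesis unfolding Complex.DeMoivre eq by (rule cis_2pi)
qed

text \<open>A geometric sum whose ratio is an \<open>n\<close>-th root of unity; the ratio differs
  from 1 because \<open>n\<close> does not divide \<open>m\<close>.\<close>

lemma sum_powers_root_of_unity:
  assumes "0 < m" "m < n"
  shows "(\<Sum>k<n. (cis (2 * pi / real n) ^ k) ^ m) = 0"
proof -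
  define w where "w = cis (2 * pi / real n) ^ m"
  have w: "w = exp (2 * of_real pi * \<i> * of_nat m / of_nat n)"
    by (simp add: w_def cis_conv_exp mult_ac flip: exp_of_nat_mult)
  have root: "cis (2 * pi / real n) ^ n = 1"
    using assms by (intro cis_root_of_unity) simp
  have "w \<noteq> 1"
    using assms by (subst w, subst complex_root_unity_eq_1) (auto dest: dvd_imp_le)
  moreover have "w ^ n = 1"
    by (metis w_def root power_mult mult.commute power_one)
  ultimately have "(\<Sum>k<n. w ^ k) = 0"
    by (simp add: geometric_sum)
  then show ?thesis by (simp add: w_def mult.commute flip: power_mult)
qed

text \<open>
  Averaging \<open>g\<close> over the rotations by \<open>n\<close>-th roots of unity keeps its values in the convex set
  and kills the coefficients between \<open>0\<close> and \<open>n\<close>.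
\<close>

lemma rogosinski_convex_coeff_bound:
  assumes D: "convex D" "D \<subseteq> S" and S: "open S" and \<phi>: "\<phi> holomorphic_on S" "0 \<in> S"
    and bd: "\<And>u. u \<in> D \<Longrightarrow> cmod (\<phi> u) \<le> 1"
    and g: "g holomorphic_on ball 0 1" "g 0 = 0" "\<And>z. z \<in> ball 0 1 \<Longrightarrow> g z \<in> D"
    and G: "g has_fps_expansion G" and n: "n > 0"
  shows "cmod (deriv \<phi> 0 * G $ n) \<le> 1"
proof -
  define \<zeta> where "\<zeta> = cis (2 * pi / real n)"
  define h where "h = (\<lambda>z. \<Sum>k<n. of_real (1 / real n) * g (\<zeta> ^ k * z))"
  define H where "H = (\<Sum>k<n. fps_const (of_real (1 / real n)) * (G oo (fps_const (\<zeta> ^ k) * fps_X)))"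
  have root: "\<zeta> ^ n = 1"
    unfolding \<zeta>_def by (rule cis_root_of_unity[OF n])
  have rot: "\<zeta> ^ k * z \<in> ball 0 1" if "z \<in> ball 0 1" for k z
    using that by (simp add: \<zeta>_def norm_mult norm_power)
  have hD: "h z \<in> D" if "z \<in> ball 0 1" for z
  proof -
    \<comment> \<open>A convex combination with equal weights of values of \<open>g\<close>, all of
      which lie in \<open>D\<close>.\<close>
    have "(\<Sum>k<n. (1 / real n) *\<^sub>R g (\<zeta> ^ k * z)) \<in> D"
      using n g(3) rot[OF that] D by (intro convex_sum) auto
    then show ?thesis by (simp add: h_def scaleR_conv_of_real)
  qed
  have hhol: "h holomorphic_on ball 0 1"
    unfolding h_def
  proof (intro holomorphic_intros)
    fix k
    have "(g \<circ> (\<lambda>z. \<zeta> ^ k * z)) holomorphic_on ball 0 1"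
      using rot by (intro holomorphic_on_compose holomorphic_intros holomorphic_on_subset[OF g(1)]) blast
    then show "(\<lambda>z. g (\<zeta> ^ k * z)) holomorphic_on ball 0 1" by (simp add: o_def)
  qed
  have hH: "h has_fps_expansion H"
    unfolding h_def H_def
  proof (intro has_fps_expansion_sum has_fps_expansion_cmult_left)
    fix k
    have "(g \<circ> (\<lambda>z. \<zeta> ^ k * z)) has_fps_expansion (G oo (fps_const (\<zeta> ^ k) * fps_X))"
      by (intro has_fps_expansion_compose[OF G] has_fps_expansion_cmult_left has_fps_expansion_fps_X) simp
    then show "(\<lambda>z. g (\<zeta> ^ k * z)) has_fps_expansion (G oo (fps_const (\<zeta> ^ k) * fps_X))"
      by (simp add: o_def)
  qed
  have G0: "G $ 0 = 0"
    using has_fps_expansion_imp_0_eq_fps_nth_0[OF G] g(2) by simp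
  have Hnth: "H $ m = G $ m * (\<Sum>k<n. (\<zeta> ^ k) ^ m) / of_nat n" for m
    by (simp add: H_def fps_sum_nth fps_compose_linear sum_distrib_left sum_divide_distrib)
      (simp add: mult_ac)
  have Hlow: "H $ m = 0" if "m < n" for m
  proof (cases "m = 0")
    case True
    then show ?thesis by (simp add: Hnth G0)
  next
    case False
    then show ?thesis using sum_powers_root_of_unity[of m n] that by (simp add: Hnth \<zeta>_def)
  qed
  \<comment> \<open>All \<open>n\<close> rotations act trivially on \<open>z ^ n\<close>, so
    averaging preserves the coefficient of order \<open>n\<close>.\<close>
  have "(\<zeta> ^ k) ^ n = 1" for k
    by (metis root power_mult mult.commute power_one)
  then have Hn: "H $ n = G $ n"
    using n by (simp add: Hnth)
  define P where "P = fps_expansion \<phi> 0"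
  have P: "\<phi> has_fps_expansion P"
    unfolding P_def by (rule has_fps_expansion_fps_expansion[OF S \<phi>(2,1)])
  \<comment> \<open>The composition is bounded by 1 because \<open>h\<close> stays in
    \<open>D\<close>. As \<open>H\<close> vanishes below order \<open>n\<close>, its coefficient of
    order \<open>n\<close> is linear in that of \<open>g\<close>, with factor
    \<open>\<phi>'(0)\<close>.\<close>
  have "(\<phi> \<circ> h) has_fps_expansion (P oo H)"
    using Hlow n by (intro has_fps_expansion_compose P hH) auto
  moreover have "(\<phi> \<circ> h) holomorphic_on ball 0 1"
    using hD D(2) by (intro holomorphic_on_compose hhol holomorphic_on_subset[OF \<phi>(1)]) auto
  ultimately have "cmod ((P oo H) $ n) \<le> 1"
    using hD bd by (intro cauchy_coeff_bound) auto
  moreover have "(P oo H) $ n = deriv \<phi> 0 * G $ n"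
    using Hlow n by (subst fps_compose_nth_initial) (auto simp: Hn P_def fps_expansion_def)
  ultimately show ?thesis by simp
qed

section \<open>Convexity of the image of the disc under arcsin\<close>

lemma convex_on_sinh_nonneg: "convex_on {0..} (sinh :: real \<Rightarrow> real)"
  by (rule f''_ge0_imp_convex[where f' = cosh and f'' = sinh])
     (auto intro!: derivative_eq_intros)

lemma concave_on_cos: "concave_on {-(pi/2)..pi/2} (cos :: real \<Rightarrow> real)"
  by (rule f''_le0_imp_concave[where f' = "\<lambda>x. - sin x" and f'' = "\<lambda>x. - cos x"])
     (auto intro!: derivative_eq_intros cos_ge_zero)

text \<open>With \<open>u = x + iy\<close>, the squared modulus of \<open>sin u\<close> equals
  \<open>1 - cos(x)^2 + sinh(y)^2\<close>. The hypothesis makes \<open>cos x\<close> nonnegative, so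
  the squares can be removed from the comparison.\<close>

lemma cmod_sin_less_1_iff:
  assumes "\<bar>Re u\<bar> \<le> pi / 2"
  shows "cmod (sin u) < 1 \<longleftrightarrow> sinh \<bar>Im u\<bar> < cos (Re u)"
proof -
  have c: "cos (Re u) \<ge> 0" using assms by (intro cos_ge_zero) auto
  have "(cmod (sin u))\<^sup>2 = (sin (Re u) * cosh (Im u))\<^sup>2 + (cos (Re u) * sinh (Im u))\<^sup>2"
    by (simp add: cmod_power2 Re_sin Im_sin cosh_def sinh_def field_simps)
  also have "\<dots> = 1 - (cos (Re u))\<^sup>2 + (sinh \<bar>Im u\<bar>)\<^sup>2"
    unfolding power_mult_distrib cosh_square_eq sin_squared_eq
    by (simp add: algebra_simps abs_if)
  finally have e: "(cmod (sin u))\<^sup>2 = 1 - (cos (Re u))\<^sup>2 + (sinh \<bar>Im u\<bar>)\<^sup>2" .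
  have "cmod (sin u) < 1 \<longleftrightarrow> (cmod (sin u))\<^sup>2 < 1"
    by (simp add: power_less_one_iff)
  also have "\<dots> \<longleftrightarrow> (sinh \<bar>Im u\<bar>)\<^sup>2 < (cos (Re u))\<^sup>2" by (auto simp: e)
  also have "\<dots> \<longleftrightarrow> sinh \<bar>Im u\<bar> < cos (Re u)"
    using c by (meson abs_ge_zero power_less_imp_less_base power_strict_mono sinh_real_nonneg_iff zero_less_numeral)
  finally show ?thesis .
qed

text \<open>This is the image of the open unit disc under \<open>Arcsin\<close>. Describing it
  through \<open>sin\<close> makes the bound on the inverse map immediate.\<close>

definition arcsin_region :: "complex set" where
  "arcsin_region = {u. \<bar>Re u\<bar> < pi / 2 \<and> cmod (sin u) < 1}"

lemma Arcsin_in_region: "cmod w < 1 \<Longrightarrow> Arcsin w \<in> arcsin_region"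
  using Arcsin_bounds[of w] abs_Re_le_cmod[of w] by (simp add: arcsin_region_def)

text \<open>In the form \<open>sinh |y| < cos x\<close>, the region compares a convex function,
  increasing in \<open>|y|\<close>, with a concave one.\<close>

lemma convex_arcsin_region: "convex arcsin_region"
proof (rule convexI)
  fix u v :: complex and s t :: real
  assume u: "u \<in> arcsin_region" and v: "v \<in> arcsin_region" and st: "0 \<le> s" "0 \<le> t" "s + t = 1"
  let ?w = "s *\<^sub>R u + t *\<^sub>R v"
  have ru: "\<bar>Re u\<bar> < pi / 2" and rv: "\<bar>Re v\<bar> < pi / 2"
    using u v by (auto simp: arcsin_region_def)
  have su: "sinh \<bar>Im u\<bar> < cos (Re u)" and sv: "sinh \<bar>Im v\<bar> < cos (Re v)"
    using u v cmod_sin_less_1_iff[of u] cmod_sin_less_1_iff[of v] by (auto simp: arcsin_region_def)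
  have "convex {-(pi/2)<..<pi/2}" by simp
  then have "s *\<^sub>R Re u + t *\<^sub>R Re v \<in> {-(pi/2)<..<pi/2}"
    using ru rv st by (intro convexD) auto
  then have rw: "\<bar>Re ?w\<bar> < pi / 2" unfolding abs_less_iff by simp
  have "\<bar>Im ?w\<bar> \<le> s * \<bar>Im u\<bar> + t * \<bar>Im v\<bar>"
    using st abs_triangle_ineq[of "s * Im u" "t * Im v"] by (simp add: abs_mult)
  then have "sinh \<bar>Im ?w\<bar> \<le> sinh (s * \<bar>Im u\<bar> + t * \<bar>Im v\<bar>)"
    by (simp only: sinh_real_le_iff)
  also have "\<dots> \<le> s * sinh \<bar>Im u\<bar> + t * sinh \<bar>Im v\<bar>"
    using convex_on_sinh_nonneg st unfolding convex_on_def by (simp del: sinh_real_abs)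
  \<comment> \<open>Strictness needs a positive weight: either \<open>s\<close> is positive, or
    \<open>s = 0\<close> and then \<open>t = 1\<close>.\<close>
  also have "\<dots> < s * cos (Re u) + t * cos (Re v)"
  proof (cases "s = 0")
    case False
    then show ?thesis
      using st su sv by (intro add_less_le_mono mult_strict_left_mono mult_left_mono) auto
  qed (use st sv in auto)
  also have "\<dots> \<le> cos (s * Re u + t * Re v)"
  proof -
    have "Re u \<in> {-(pi/2)..pi/2}" "Re v \<in> {-(pi/2)..pi/2}"
      using ru rv unfolding abs_less_iff by auto
    then show ?thesis using concave_on_cos st unfolding concave_on_iff by simp
  qed
  finally show "?w \<in> arcsin_region"
    using rw cmod_sin_less_1_iff[of ?w] by (simp add: arcsin_region_def)
qed

section \<open>Schwarz functions and the logarithmic derivative\<close>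

text \<open>Modulus 1 at an interior point would be a maximum, making \<open>\<omega>\<close>
  constant and hence 0. The strict bound keeps the values of \<open>\<omega>\<close> where
  \<open>Arcsin\<close> is holomorphic.\<close>

lemma schwarz_function_less_1:
  assumes "schwarz_function \<omega>" "z \<in> unit_disc"
  shows "cmod (\<omega> z) < 1"
proof (rule ccontr)
  assume "\<not> cmod (\<omega> z) < 1"
  then have "\<omega> constant_on unit_disc"
    using assms unfolding schwarz_function_def
    by (intro maximum_modulus_principle[where U = unit_disc and \<xi> = z]) (auto simp: not_less intro: order_trans[of _ 1])
  then have "\<omega> z = \<omega> 0"
    using assms(2) by (auto simp: constant_on_def)
  then show False
    using \<open>\<not> cmod (\<omega> z) < 1\<close> assms(1) by (simp add: schwarz_function_def)
qed

lemma holomorphic_on_Arcsin_unit_disc: "Arcsin holomorphic_on unit_disc"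
proof (rule holomorphic_on_Arcsin)
  fix z :: complex assume "z \<in> unit_disc"
  then show "\<bar>Re z\<bar> < 1" using abs_Re_le_cmod[of z] by simp
qed

lemma holomorphic_on_Arcsin_compose:
  assumes "\<omega> holomorphic_on A" "\<And>z. z \<in> A \<Longrightarrow> cmod (\<omega> z) < 1"
  shows "(\<lambda>z. Arcsin (\<omega> z)) holomorphic_on A"
proof -
  have "Arcsin holomorphic_on \<omega> ` A"
    using assms(2) by (intro holomorphic_on_subset[OF holomorphic_on_Arcsin_unit_disc]) auto
  with holomorphic_on_compose[OF assms(1)] show ?thesis by (simp add: o_def)
qed

lemma log_derivative_of_log_quotient:
  assumes L: "is_log_quotient f L" and z: "z \<in> unit_disc" "z \<noteq> 0"
  shows "z * deriv f z / f z = 1 + z * deriv L z"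
proof -
  have f: "f w = w * exp (L w)" if "w \<in> unit_disc - {0}" for w
    using L that by (auto simp: is_log_quotient_def)
  have dL: "(L has_field_derivative deriv L z) (at z)"
    using L z by (intro holomorphic_derivI[of _ unit_disc]) (auto simp: is_log_quotient_def)
  have "((\<lambda>w. w * exp (L w)) has_field_derivative exp (L z) + z * (exp (L z) * deriv L z)) (at z)"
    by (auto intro!: derivative_eq_intros dL)
  then have "(f has_field_derivative exp (L z) + z * (exp (L z) * deriv L z)) (at z)"
    by (rule has_field_derivative_transform_within_open[where S = "unit_disc - {0}"])
       (use z f in \<open>auto intro: open_delete\<close>)
  then have "deriv f z = exp (L z) * (1 + z * deriv L z)"
    by (auto dest: DERIV_imp_deriv simp: algebra_simps)
  then show ?thesis using f[of z] z by simp
qed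

text \<open>Differentiating \<open>f z = z * exp (L z)\<close> gives \<open>z * L'(z) = q z\<close>,
  and the operator \<open>z d/dz\<close> multiplies the coefficient of order \<open>n\<close> by
  \<open>n\<close>. The factor 2 comes from the normalization of \<open>log_coeff\<close>.\<close>

lemma log_coeff_conv_log_derivative:
  assumes f: "f \<in> class_S" and Q: "q has_fps_expansion Q" and "q 0 = 0"
    and q: "\<And>z. z \<in> unit_disc - {0} \<Longrightarrow> z * deriv f z / f z = 1 + q z"
  shows "Q $ n = 2 * of_nat n * log_coeff f n"
proof -
  let ?L = "log_quotient f"
  have L: "is_log_quotient f ?L" by (rule is_log_quotient_log_quotient[OF f])
  have LF: "?L has_fps_expansion fps_expansion ?L 0"
    using L by (intro has_fps_expansion_fps_expansion[of unit_disc]) (auto simp: is_log_quotient_def)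
  have "(\<lambda>z. z * deriv ?L z) has_fps_expansion fps_X * fps_deriv (fps_expansion ?L 0)"
    by (intro fps_expansion_intros LF)
  moreover have "\<forall>\<^sub>F z in nhds 0. z * deriv ?L z = q z"
    using eventually_nhds_in_open[of unit_disc 0, OF open_ball]
  proof (rule eventually_mono)
    fix z assume "z \<in> unit_disc"
    then show "z * deriv ?L z = q z"
      using log_derivative_of_log_quotient[OF L] q[of z] \<open>q 0 = 0\<close> by (cases "z = 0") auto
  qed simp
  ultimately have "q has_fps_expansion fps_X * fps_deriv (fps_expansion ?L 0)"
    by (subst (asm) has_fps_expansion_cong) auto
  then have "Q = fps_X * fps_deriv (fps_expansion ?L 0)"
    using Q fps_expansion_unique_complex by blast
  then show ?thesis by (cases n) (auto simp: log_coeff_def)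
qed

section \<open>The coefficient bound\<close>

text \<open>Rogosinski's bound is applied to \<open>Arcsin\<close> composed with
  \<open>\<omega>\<close>, which maps the disc into \<open>arcsin_region\<close>, with the entire
  function \<open>sin\<close> as \<open>\<phi>\<close>.\<close>

lemma log_coeff_bound_starlike_arcsin:
  assumes "f \<in> starlike_arcsin" "n > 0"
  shows "cmod (log_coeff f n) \<le> 1 / (real n * pi)"
proof -
  have f: "f \<in> class_S" using assms by (simp add: starlike_arcsin_def)
  obtain \<omega> where \<omega>: "schwarz_function \<omega>"
    and sub: "\<And>z. z \<in> unit_disc \<Longrightarrow>
      (if z = 0 then 1 else z * deriv f z / f z) = 1 + 2 / of_real pi * Arcsin (\<omega> z)"
    using assms by (auto simp: starlike_arcsin_def subordinate_def)
  define g where "g = (\<lambda>z. Arcsin (\<omega> z))"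
  have g0: "g 0 = 0" using \<omega> by (simp add: g_def schwarz_function_def)
  have ghol: "g holomorphic_on unit_disc"
    unfolding g_def using \<omega> schwarz_function_less_1[OF \<omega>]
    by (intro holomorphic_on_Arcsin_compose) (auto simp: schwarz_function_def)
  define G where "G = fps_expansion g 0"
  have G: "g has_fps_expansion G"
    unfolding G_def by (rule has_fps_expansion_fps_expansion[OF open_ball _ ghol]) simp
  have "cmod (deriv sin 0 * G $ n) \<le> 1"
    using schwarz_function_less_1[OF \<omega>] assms(2) g0 ghol G
    by (intro rogosinski_convex_coeff_bound[of arcsin_region UNIV sin g] convex_arcsin_region holomorphic_intros)
       (auto simp: g_def Arcsin_in_region, auto simp: arcsin_region_def)
  moreover have "deriv sin (0::complex) = 1"
    by (rule DERIV_imp_deriv) (auto intro!: derivative_eq_intros)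
  ultimately have le: "cmod (G $ n) \<le> 1" by simp
  have lg: "z * deriv f z / f z = 1 + 2 / of_real pi * g z" if "z \<in> unit_disc - {0}" for z
    using sub[of z] that by (simp add: g_def)
  have "(fps_const (2 / of_real pi) * G) $ n = 2 * of_nat n * log_coeff f n"
    by (rule log_coeff_conv_log_derivative[OF f has_fps_expansion_cmult_left[OF G]])
       (use lg g0 in auto)
  then have "log_coeff f n = G $ n / (of_nat n * of_real pi)"
    using assms(2) by (simp add: field_simps)
  then show ?thesis
    using le assms(2) by (simp add: norm_divide norm_mult divide_right_mono)
qed

section \<open>Univalence and the extremal functions\<close>

text \<open>If \<open>f a = f b\<close>, the mean value theorem for the real part of
  \<open>f / (b - a)\<close> on the segment yields a point where
  \<open>Re (f' u) = 0\<close>.\<close>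

lemma noshiro_warschawski:
  assumes "convex S" and f: "\<And>z. z \<in> S \<Longrightarrow> (f has_field_derivative f' z) (at z)"
    and pos: "\<And>z. z \<in> S \<Longrightarrow> Re (f' z) > 0"
  shows "inj_on f S"
proof (rule inj_onI, rule ccontr)
  fix a b assume ab: "a \<in> S" "b \<in> S" "f a = f b" "a \<noteq> b"
  have seg: "closed_segment a b \<subseteq> S"
    using ab \<open>convex S\<close> by (simp add: closed_segment_subset)
  have "\<exists>u. u \<in> closed_segment a b \<and>
      Re (f b / (b - a)) - Re (f a / (b - a)) = Re (f' u / (b - a) * (b - a))"
    using seg f by (intro complex_mvt_line DERIV_cdivide) auto
  then obtain u where "u \<in> closed_segment a b" "Re (f' u) = 0"
    using ab by auto
  then show False using pos[of u] seg by auto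
qed

text \<open>
  In the logarithmic coordinate \<open>z = exp \<zeta>\<close> the function becomes \<open>\<zeta> + L (exp \<zeta>)\<close>, whose derivative
  on the left half-plane has positive real part by starlikeness.
\<close>

lemma starlike_imp_univalent:
  assumes L: "L holomorphic_on unit_disc"
    and pos: "\<And>z. z \<in> unit_disc \<Longrightarrow> Re (1 + z * deriv L z) > 0"
  shows "inj_on (\<lambda>z. z * exp (L z)) unit_disc"
proof (rule inj_onI)
  fix a b assume ab: "a \<in> unit_disc" "b \<in> unit_disc" "a * exp (L a) = b * exp (L b)"
  define S where "S = {\<zeta>::complex. Re \<zeta> < 0}"
  define \<Phi> where "\<Phi> = (\<lambda>\<zeta>. \<zeta> + L (exp \<zeta>))"
  have inj: "inj_on \<Phi> S"
  proof (rule noshiro_warschawski[where f' = "\<lambda>\<zeta>. 1 + exp \<zeta> * deriv L (exp \<zeta>)"])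
    show "convex S" unfolding S_def by (rule convex_halfspace_Re_lt)
    fix \<zeta> assume "\<zeta> \<in> S"
    then have e: "exp \<zeta> \<in> unit_disc" by (simp add: S_def norm_exp_eq_Re)
    show "Re (1 + exp \<zeta> * deriv L (exp \<zeta>)) > 0" by (rule pos[OF e])
    have "(L has_field_derivative deriv L (exp \<zeta>)) (at (exp \<zeta>))"
      using e L by (intro holomorphic_derivI[of _ unit_disc]) auto
    from DERIV_chain2[OF this DERIV_exp]
    show "(\<Phi> has_field_derivative 1 + exp \<zeta> * deriv L (exp \<zeta>)) (at \<zeta>)"
      unfolding \<Phi>_def by (auto intro!: derivative_eq_intros simp: mult.commute)
  qed
  show "a = b"
  proof (cases "a = 0 \<or> b = 0")
    case True
    then show ?thesis using ab(3) by auto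
  next
    case False
    then have "exp (\<Phi> (Ln a)) = exp (\<Phi> (Ln b))"
      using ab(3) by (simp add: \<Phi>_def exp_add)
    then obtain k :: int where k: "\<Phi> (Ln a) = \<Phi> (Ln b) + (of_int (2 * k) * pi) * \<i>"
      by (auto simp: exp_eq)
    \<comment> \<open>Another logarithm of \<open>b\<close>, chosen to absorb the period:
      \<open>L (exp \<zeta>)\<close> and the real part are unchanged, so injectivity of
      \<open>\<Phi>\<close> on the half-plane applies.\<close>
    define \<beta> where "\<beta> = Ln b + (of_int (2 * k) * pi) * \<i>"
    have eb: "exp \<beta> = b"
      using False exp_eq[of \<beta> "Ln b"] by (auto simp: \<beta>_def)
    then have "\<Phi> (Ln a) = \<Phi> \<beta>"
      using k False by (simp add: \<Phi>_def \<beta>_def)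
    moreover have "Ln a \<in> S" "\<beta> \<in> S"
      using ab False by (auto simp: S_def \<beta>_def)
    ultimately have "Ln a = \<beta>" using inj by (auto dest: inj_onD)
    then show ?thesis using eb False by (metis exp_Ln)
  qed
qed

text \<open>The choice \<open>\<omega> z = z ^ n\<close> prescribes \<open>z * L'(z) = q z\<close>;
  integrating gives \<open>L\<close> and then \<open>f z = z * exp (L z)\<close>. The leading
  coefficient of \<open>Arcsin (z ^ n)\<close> is 1, which gives the equality.\<close>

lemma starlike_arcsin_extremal:
  assumes n: "n > 0"
  obtains f where "f \<in> starlike_arcsin" "log_coeff f n = 1 / (of_nat n * of_real pi)"
proof -
  define q where "q = (\<lambda>z::complex. 2 / of_real pi * Arcsin (z ^ n))"
  have lt: "cmod (z ^ n) < 1" if "z \<in> unit_disc" for z :: complex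
    using that n by (simp add: norm_power power_less_one_iff)
  have qhol: "q holomorphic_on unit_disc"
    unfolding q_def using lt by (intro holomorphic_intros holomorphic_on_Arcsin_compose) auto
  have q0: "q 0 = 0" using n by (simp add: q_def power_0_left)
  \<comment> \<open>The singularity of \<open>q z / z\<close> at 0 is removable, so this quotient
    has a primitive on the convex disc.\<close>
  have "(\<lambda>z. if z = 0 then deriv q 0 else (q z - q 0) / (z - 0)) holomorphic_on unit_disc"
    by (rule pole_theorem_open_0[where a = 0 and g = q]) (use qhol q0 in auto)
  then obtain M where M: "\<And>z. z \<in> unit_disc \<Longrightarrow>
      (M has_field_derivative (if z = 0 then deriv q 0 else q z / z)) (at z)"
    using holomorphic_convex_primitive'[OF convex_ball open_ball] q0
    by (metis (no_types, lifting) at_within_open diff_zero open_ball)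
  define L where "L = (\<lambda>z. M z - M 0)"
  have dL: "(L has_field_derivative (if z = 0 then deriv q 0 else q z / z)) (at z)"
    if "z \<in> unit_disc" for z
    unfolding L_def using M[OF that] by (auto intro!: derivative_eq_intros)
  have L0: "L 0 = 0" by (simp add: L_def)
  have Lhol: "L holomorphic_on unit_disc"
    using dL by (meson field_differentiable_at_within field_differentiable_def holomorphic_on_def)
  have zL: "z * deriv L z = q z" if "z \<in> unit_disc" for z
    using DERIV_imp_deriv[OF dL[OF that]] q0 by auto
  define f where "f = (\<lambda>z. z * exp (L z))"
  have "inj_on f unit_disc"
    unfolding f_def
  proof (rule starlike_imp_univalent[OF Lhol])
    fix z :: complex assume z: "z \<in> unit_disc"
    have "\<bar>Re (Arcsin (z ^ n))\<bar> < pi / 2"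
      using Arcsin_in_region[OF lt[OF z]] by (simp add: arcsin_region_def)
    moreover have "q z = (2 / pi) *\<^sub>R Arcsin (z ^ n)"
      by (simp add: q_def scaleR_conv_of_real)
    \<comment> \<open>The factor \<open>2 / pi\<close> turns the bound \<open>pi / 2\<close> for the
      real part of \<open>Arcsin\<close> into 1, which is exactly what starlikeness
      requires.\<close>
    ultimately have "Re (q z) > -1" by (simp add: field_simps abs_less_iff)
    then show "Re (1 + z * deriv L z) > 0" using zL[OF z] by simp
  qed
  moreover have "deriv f 0 = 1"
    unfolding f_def
    by (intro DERIV_imp_deriv) (auto intro!: derivative_eq_intros dL simp: L0)
  ultimately have fS: "f \<in> class_S"
    using Lhol by (auto simp: class_S_def class_A_def f_def intro!: holomorphic_intros)
  have L: "is_log_quotient f L"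
    using Lhol by (auto simp: is_log_quotient_def L0 f_def)
  have fq: "z * deriv f z / f z = 1 + q z" if "z \<in> unit_disc - {0}" for z
    using log_derivative_of_log_quotient[OF L] zL that by auto
  have "schwarz_function (\<lambda>z. z ^ n)"
    using lt n by (auto simp: schwarz_function_def intro!: holomorphic_intros less_imp_le)
  then have "f \<in> starlike_arcsin"
    using fS fq q0 n unfolding starlike_arcsin_def subordinate_def
    by (auto simp: q_def intro!: exI[of _ "\<lambda>z. z ^ n"])
  moreover have "log_coeff f n = 1 / (of_nat n * of_real pi)"
  proof -
    define A where "A = fps_expansion Arcsin 0"
    have A: "Arcsin has_fps_expansion A"
      unfolding A_def
      by (rule has_fps_expansion_fps_expansion[OF open_ball _ holomorphic_on_Arcsin_unit_disc]) simp
    have "deriv Arcsin 0 = 1"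
      using has_field_derivative_Arcsin[of 0] by (auto dest: DERIV_imp_deriv)
    then have A1: "A $ 1 = 1" by (simp add: A_def fps_expansion_def)
    have "(Arcsin \<circ> (\<lambda>z. z ^ n)) has_fps_expansion (A oo fps_X ^ n)"
      using n by (intro has_fps_expansion_compose A fps_expansion_intros) auto
    then have "q has_fps_expansion fps_const (2 / of_real pi) * (A oo fps_X ^ n)"
      unfolding q_def o_def by (rule has_fps_expansion_cmult_left)
    from log_coeff_conv_log_derivative[OF fS this q0 fq, of n]
    have "2 / of_real pi * (A oo fps_X ^ n) $ n = 2 * of_nat n * log_coeff f n" by simp
    \<comment> \<open>The inner series starts at order \<open>n\<close> with coefficient 1, so only
      \<open>A $ 1\<close> enters.\<close>
    moreover have "(A oo fps_X ^ n) $ n = 1"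
      using n A1 by (subst fps_compose_nth_initial) (auto simp: fps_X_power_nth)
    ultimately show ?thesis using n by (simp add: field_simps)
  qed
  ultimately show thesis by (rule that)
qed

theorem theorem4p1:
  shows "(\<forall>f \<in> starlike_arcsin. \<forall>n \<in> {1, 2, 3, 4 :: nat}.
            cmod (log_coeff f n) \<le> 1 / (real n * pi)) \<and>
         (\<forall>n \<in> {1, 2, 3, 4 :: nat}. \<exists>f \<in> starlike_arcsin.
            cmod (log_coeff f n) = 1 / (real n * pi))"
proof (intro conjI ballI)
  fix f and n :: nat
  assume "f \<in> starlike_arcsin" "n \<in> {1, 2, 3, 4}"
  then show "cmod (log_coeff f n) \<le> 1 / (real n * pi)"
    by (intro log_coeff_bound_starlike_arcsin) auto
next
  fix n :: nat
  assume "n \<in> {1, 2, 3, 4}"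
  then have "n > 0" by auto
  then obtain f where "f \<in> starlike_arcsin" "log_coeff f n = 1 / (of_nat n * of_real pi)"
    by (rule starlike_arcsin_extremal)
  then show "\<exists>f \<in> starlike_arcsin. cmod (log_coeff f n) = 1 / (real n * pi)"
    by (intro bexI[of _ f]) (simp_all add: norm_divide norm_mult)
qed

end
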